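(* Let $(X,\|\cdot\|)$ be a normed linear space over $\mathbb{C}$, let $c_0,\dots,c_n\in X$ with $c_n\ne 0$, and let $P:\mathbb{C}\to X$ be the polynomial $P(z)=c_0+zc_1+z^2c_2+\cdots+z^nc_n$. Suppose there are $x_0\in X$ and $R>0$ such that $\|c_k-x_0\|\le R$ for every $k\in\{0,\dots,n\}$. Then $$\left\|P(z)-\frac{z^{n+1}-1}{z-1}\cdot\frac{1}{n+1}\sum_{k=0}^n c_k\right\|\le R\sum_{k=0}^n\left|z^k-\frac{1}{n+1}\cdot\frac{z^{n+1}-1}{z-1}\right|$$ for all $z\in\mathbb{C}$ with $z\ne 1$. *)

theory Defs
  imports Complex_Main
begin

text \<open>
  The distribution has no type class of complex normed spaces, so a normed linear space over the
  complex numbers is a complex vector space \<open>('a, scale)\<close>, in the sense of the library locale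
  \<^locale>\<open>vector_space\<close>, equipped with a norm \<open>nrm\<close>. Nonnegativity of \<open>nrm\<close> follows from the
  axioms, as in \<^class>\<open>real_normed_vector\<close>.
\<close>

locale complex_normed_space = vector_space scale
  for scale :: "complex \<Rightarrow> 'a::ab_group_add \<Rightarrow> 'a" +
  fixes nrm :: "'a \<Rightarrow> real"
  assumes nrm_eq_zero: "nrm x = 0 \<longleftrightarrow> x = 0"
    and nrm_triangle_ineq: "nrm (x + y) \<le> nrm x + nrm y"
    and nrm_scale: "nrm (scale a x) = cmod a * nrm x"

lemma (in complex_normed_space) nrm_nonneg: "0 \<le> nrm x"
proof -
  have "nrm (scale (-1) x) = nrm x" by (subst nrm_scale) simp
  moreover have "scale (-1) x = - x" by (simp add: scale_minus_left)
  moreover have "nrm 0 = 0" by (simp add: nrm_eq_zero)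
  ultimately show ?thesis using nrm_triangle_ineq[of x "- x"] by simp
qed

end

theory Submission
  imports Defs
begin

text \<open>
  The deviations of the numbers \<open>z ^ k\<close> from their mean sum to zero, and the vector to be estimated
  is the combination of the \<open>c k\<close> with these deviations as coefficients. Hence each \<open>c k\<close> may be
  replaced by \<open>c k - x0\<close>, and the triangle inequality applies.
\<close>

context complex_normed_space
begin

lemma nrm_sum_le: "nrm (\<Sum>i\<in>A. f i) \<le> (\<Sum>i\<in>A. nrm (f i))"
proof (induction A rule: infinite_finite_induct)
  case (insert i A)
  then show ?case using nrm_triangle_ineq[of "f i" "\<Sum>i\<in>A. f i"] by simp
\<comment> \<open>An empty sum and, by convention, a sum over an infinite set are 0, so both cases
  reduce to \<open>nrm 0 = 0\<close>.\<close>
qed (simp_all add: eq_refl nrm_eq_zero)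

text \<open>Kept general in the coefficients: the theorem is the case \<open>a k = z ^ k\<close>,
  where \<open>sum a A\<close> becomes the geometric sum.\<close>

lemma nrm_weighted_sum_minus_mean_le:
  assumes "finite A" "A \<noteq> {}"
    and bound: "\<And>i. i \<in> A \<Longrightarrow> nrm (c i - x0) \<le> R"
  shows "nrm ((\<Sum>i\<in>A. scale (a i) (c i)) - scale (sum a A) (scale (1 / of_nat (card A)) (sum c A)))
    \<le> R * (\<Sum>i\<in>A. cmod (a i - 1 / of_nat (card A) * sum a A))"
proof -
  define m where "m = 1 / of_nat (card A) * sum a A"
  \<comment> \<open>Finiteness and nonemptiness of \<open>A\<close> make \<open>card A\<close>
    nonzero, so the division in \<open>m\<close> cancels.\<close>
  have "of_nat (card A) * m = sum a A"
    using assms(1,2) by (simp add: m_def)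
  then have "(\<Sum>i\<in>A. a i - m) = 0"
    by (simp add: sum_subtractf)
  then have "(\<Sum>i\<in>A. scale (a i - m) x0) = 0"
    by (simp flip: scale_sum_left)
  \<comment> \<open>The two nested scalings combine into the single factor \<open>m\<close>, which
    distributes over \<open>sum c A\<close>.\<close>
  moreover have "(\<Sum>i\<in>A. scale (a i) (c i)) - scale (sum a A) (scale (1 / of_nat (card A)) (sum c A))
      = (\<Sum>i\<in>A. scale (a i - m) (c i))"
    by (simp add: scale_left_diff_distrib sum_subtractf scale_sum_right m_def mult.commute)
  ultimately have "(\<Sum>i\<in>A. scale (a i) (c i))
        - scale (sum a A) (scale (1 / of_nat (card A)) (sum c A))
      = (\<Sum>i\<in>A. scale (a i - m) (c i - x0))"
    by (simp add: scale_right_diff_distrib sum_subtractf)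
  also have "nrm \<dots> \<le> (\<Sum>i\<in>A. cmod (a i - m) * nrm (c i - x0))"
    using nrm_sum_le[of "\<lambda>i. scale (a i - m) (c i - x0)" A] by (simp add: nrm_scale)
  also have "\<dots> \<le> (\<Sum>i\<in>A. cmod (a i - m) * R)"
    by (intro sum_mono mult_left_mono bound) auto
  also have "\<dots> = R * (\<Sum>i\<in>A. cmod (a i - m))"
    by (simp add: sum_distrib_left mult.commute)
  finally show ?thesis
    by (simp add: m_def)
qed

end

theorem theorem8:
  fixes scale :: "complex \<Rightarrow> 'a::ab_group_add \<Rightarrow> 'a"
    and nrm :: "'a \<Rightarrow> real"
    and n :: nat and c :: "nat \<Rightarrow> 'a" and P :: "complex \<Rightarrow> 'a"
    and x0 :: 'a and R :: real
  assumes "complex_normed_space scale nrm"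
    and "c n \<noteq> 0"
    and "\<And>z. P z = (\<Sum>k=0..n. scale (z ^ k) (c k))"
    and "R > 0"
    and "\<And>k. k \<in> {0..n} \<Longrightarrow> nrm (c k - x0) \<le> R"
  shows "\<forall>z. z \<noteq> 1 \<longrightarrow>
    nrm (P z - scale ((z ^ (n + 1) - 1) / (z - 1))
                 (scale (1 / of_nat (n + 1)) (\<Sum>k=0..n. c k)))
      \<le> R * (\<Sum>k=0..n. cmod (z ^ k - 1 / of_nat (n + 1) * ((z ^ (n + 1) - 1) / (z - 1))))"
proof (intro allI impI)
  fix z :: complex
  assume "z \<noteq> 1"
  interpret complex_normed_space scale nrm by fact
  \<comment> \<open>\<open>geometric_sum\<close> runs over exponents below its bound, hence the
    instance \<open>n + 1\<close>, which is also the cardinality of \<open>{0..n}\<close>.\<close>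
  have "(\<Sum>k=0..n. z ^ k) = (z ^ (n + 1) - 1) / (z - 1)"
    using geometric_sum[OF \<open>z \<noteq> 1\<close>, of "n + 1"]
    by (simp add: atLeast0AtMost lessThan_Suc_atMost)
  then show "nrm (P z - scale ((z ^ (n + 1) - 1) / (z - 1))
                 (scale (1 / of_nat (n + 1)) (\<Sum>k=0..n. c k)))
      \<le> R * (\<Sum>k=0..n. cmod (z ^ k - 1 / of_nat (n + 1) * ((z ^ (n + 1) - 1) / (z - 1))))"
    using nrm_weighted_sum_minus_mean_le[of "{0..n}" c x0 R "\<lambda>k. z ^ k"] assms(3,5) by simp
qed

end
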